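(* Let $(\lambda_i)_{i=1}^n$ be a sequence of distinct points in the open unit disk $\mathbb{D}$, let $(w_i)_{i=1}^n$ be a sequence in $\mathbb{C}$, and let $C>0$. There exists $f\in W$ such that $f(\lambda_i)=w_i$ for $1\le i\le n$ and $\|f\|_W\le C$ if and only if $$\sup_{j\ge0}\Big|\sum_{i=1}^n\alpha_iw_i\lambda_i^j\Big|\le C\sup_{j\ge0}\Big|\sum_{i=1}^n\alpha_i\lambda_i^j\Big|$$ for every sequence of complex numbers $(\alpha_i)_{i=1}^n$.
   Context: $W$ is the Wiener algebra of absolutely convergent Taylor series: all $f=\sum_{j\ge0}\hat f(j)z^j$ holomorphic on $\mathbb{D}$ with $\|f\|_W=\sum_{j\ge0}|\hat f(j)|<\infty$. Convention: $\lambda_i^0=1$. *)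

theory Defs
  imports "HOL-Complex_Analysis.Complex_Analysis"
begin

text \<open>
  Elements of the Wiener algebra are functions on the open unit disk. They are represented by
  total functions, whose values outside \<^term>\<open>ball 0 1\<close> play no role: neither membership nor the
  norm depends on them. The \<open>j\<close>-th Taylor coefficient of \<open>f\<close> at the origin is
  \<open>(deriv ^^ j) f 0 / fact j\<close>, as in the library's \<^const>\<open>fps_expansion\<close>.
\<close>

definition taylor_coeff :: "(complex \<Rightarrow> complex) \<Rightarrow> nat \<Rightarrow> complex" where
  "taylor_coeff f j = fps_nth (fps_expansion f 0) j"

definition wiener_algebra :: "(complex \<Rightarrow> complex) set" where
  "wiener_algebra =
     {f. f holomorphic_on ball 0 1 \<and> summable (\<lambda>j. norm (taylor_coeff f j))}"

text \<open>Meaningful only on \<^const>\<open>wiener_algebra\<close>, where the series converges.\<close>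

definition wiener_norm :: "(complex \<Rightarrow> complex) \<Rightarrow> real" where
  "wiener_norm f = (\<Sum>j. norm (taylor_coeff f j))"

text \<open>
  Real suprema are meaningful only for sets that are bounded above. The suprema of
  exponential sums considered here are of this kind, because the nodes lie in the disk.
\<close>

lemma bdd_above_exponential_sum:
  fixes l c :: "nat \<Rightarrow> complex"
  assumes "\<And>i. i \<in> A \<Longrightarrow> norm (l i) < 1"
  shows "bdd_above (range (\<lambda>j::nat. norm (\<Sum>i\<in>A. c i * l i ^ j)))"
proof (rule bdd_aboveI2)
  fix j :: nat
  have "norm (\<Sum>i\<in>A. c i * l i ^ j) \<le> (\<Sum>i\<in>A. norm (c i * l i ^ j))"
    by (rule norm_sum)
  also have "\<dots> \<le> (\<Sum>i\<in>A. norm (c i))"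
    using assms
    by (intro sum_mono)
      (simp add: norm_mult norm_power mult_left_le power_le_one less_imp_le)
  finally show "norm (\<Sum>i\<in>A. c i * l i ^ j) \<le> (\<Sum>i\<in>A. norm (c i))" .
qed

end

theory Submission
  imports Defs
begin

text \<open>
  Necessity: if \<open>f = (\<Sum>k. a k * z ^ k)\<close> interpolates, then
  \<open>(\<Sum>i. \<alpha> i * w i * l i ^ j) = (\<Sum>k. a k * (\<Sum>i. \<alpha> i * l i ^ (j + k)))\<close>.

  Sufficiency: the coefficient sequences with \<open>\<ell>\<^sup>1\<close>-norm at most \<open>C\<close> form a convex set, compact for
  pointwise convergence, on which evaluation at a point of the disk is continuous. Hence some \<open>a\<close> in
  this set minimises the Euclidean distance from \<open>w\<close> to the tuple of values \<open>p\<close> of the power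
  series at the nodes. Let \<open>r = w - p\<close>. Varying \<open>a\<close> towards multiples of unit sequences gives
  \<open>C * \<bar>\<Sum>i. cnj (r i) * l i ^ k\<bar> \<le> Re (\<Sum>i. cnj (r i) * p i)\<close> for all \<open>k\<close>, and the hypothesis for
  \<open>\<alpha> = cnj r\<close> at \<open>j = 0\<close> turns this into
  \<open>Re (\<Sum>i. cnj (r i) * w i) \<le> Re (\<Sum>i. cnj (r i) * p i)\<close>, that is, \<open>(\<Sum>i. \<bar>r i\<bar>\<^sup>2) \<le> 0\<close>.
\<close>

section \<open>The ball of coefficient sequences: compactness and convexity\<close>

text \<open>Bounding the partial sums builds summability into membership, and each condition
  involves finitely many coordinates, hence is closed for pointwise convergence.\<close>

definition l1_ball :: "real \<Rightarrow> (nat \<Rightarrow> complex) set" where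
  "l1_ball C = {a. \<forall>N. (\<Sum>k<N. norm (a k)) \<le> C}"

lemma l1_ball_summable:
  assumes "a \<in> l1_ball C"
  shows "summable (\<lambda>k. norm (a k))" and "(\<Sum>k. norm (a k)) \<le> C"
proof -
  show "summable (\<lambda>k. norm (a k))"
    using assms by (intro summableI_nonneg_bounded[of _ C]) (auto simp: l1_ball_def)
  then show "(\<Sum>k. norm (a k)) \<le> C"
    using assms by (intro suminf_le_const) (auto simp: l1_ball_def)
qed

lemma l1_ball_norm_le:
  assumes "a \<in> l1_ball C"
  shows "norm (a k) \<le> C"
proof -
  have "norm (a k) \<le> (\<Sum>m<Suc k. norm (a m))"
    by (simp add: sum_nonneg)
  also have "\<dots> \<le> C"
    using assms unfolding l1_ball_def by blast
  finally show ?thesis .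
qed

text \<open>Every coordinate is bounded by \<open>C\<close>, so the set is a closed subset of a
  product of closed disks, which is compact by Tychonoff.\<close>

lemma compact_l1_ball: "compact (l1_ball C)"
proof -
  have "compactin (product_topology (\<lambda>_. euclidean) UNIV) (PiE UNIV (\<lambda>_::nat. cball (0::complex) C))"
    unfolding compactin_PiE by (simp add: compact_cball)
  then have "compact (PiE UNIV (\<lambda>_::nat. cball (0::complex) C))"
    by (simp add: euclidean_product_topology)
  moreover have "closed {a::nat \<Rightarrow> complex. (\<Sum>k<N. norm (a k)) \<le> C}" for N
    by (intro closed_Collect_le continuous_intros continuous_on_product_coordinates)
  then have "closed (\<Inter>N. {a::nat \<Rightarrow> complex. (\<Sum>k<N. norm (a k)) \<le> C})"
    by blast
  moreover have "l1_ball C = PiE UNIV (\<lambda>_. cball 0 C) \<inter>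
      (\<Inter>N. {a. (\<Sum>k<N. norm (a k)) \<le> C})"
    using l1_ball_norm_le by (auto simp: l1_ball_def)
  ultimately show ?thesis
    by (simp add: compact_Int_closed)
qed

lemma convex_combination_in_l1_ball:
  assumes "a \<in> l1_ball C" "b \<in> l1_ball C" "0 \<le> t" "t \<le> 1"
  shows "(\<lambda>k. a k + of_real t * (b k - a k)) \<in> l1_ball C"
proof -
  have "(\<Sum>k<N. norm (a k + of_real t * (b k - a k))) \<le> C" for N
  proof -
    have "norm (a k + of_real t * (b k - a k)) \<le> (1 - t) * norm (a k) + t * norm (b k)" for k
    proof -
      have "a k + of_real t * (b k - a k) = of_real (1 - t) * a k + of_real t * b k"
        by (simp add: algebra_simps)
      then show ?thesis
        using assms(3,4) norm_triangle_ineq[of "of_real (1 - t) * a k" "of_real t * b k"]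
        by (simp add: norm_mult del: of_real_diff)
    qed
    then have "(\<Sum>k<N. norm (a k + of_real t * (b k - a k)))
        \<le> (\<Sum>k<N. (1 - t) * norm (a k) + t * norm (b k))"
      by (intro sum_mono)
    also have "\<dots> = (1 - t) * (\<Sum>k<N. norm (a k)) + t * (\<Sum>k<N. norm (b k))"
      by (simp add: sum.distrib sum_distrib_left)
    also have "\<dots> \<le> (1 - t) * C + t * C"
      using assms by (intro add_mono mult_left_mono) (auto simp: l1_ball_def)
    finally show ?thesis
      by (simp add: algebra_simps)
  qed
  then show ?thesis
    by (simp add: l1_ball_def)
qed

lemma unit_sequence_in_l1_ball:
  assumes "norm c \<le> C"
  shows "(\<lambda>k. if k = m then c else 0) \<in> l1_ball C"
proof -
  have "0 \<le> C"
    using assms norm_ge_zero order_trans by blast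
  then show ?thesis
    using assms by (auto simp: l1_ball_def if_distrib[of norm] sum.delta' cong: if_cong)
qed

section \<open>Power series on the disk and the Wiener algebra\<close>

lemma summable_power_series_disk:
  fixes a :: "nat \<Rightarrow> complex"
  assumes "summable (\<lambda>k. norm (a k))" "norm z \<le> 1"
  shows "summable (\<lambda>k. a k * z ^ k)"
proof (rule summable_comparison_test'[OF assms(1)])
  show "norm (a k * z ^ k) \<le> norm (a k)" if "0 \<le> k" for k
    using assms(2) by (simp add: norm_mult norm_power mult_left_le power_le_one)
qed

text \<open>The partial sums are continuous in the coordinates and converge uniformly on the ball,
  with majorant \<open>C * norm z ^ k\<close>. At \<open>norm z = 1\<close> with
  \<open>C > 0\<close> this breaks down: \<open>C\<close> times the unit sequences tend pointwise to
  zero, but their values keep modulus \<open>C\<close>.\<close>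

lemma continuous_on_power_series_eval:
  assumes "norm z < 1"
  shows "continuous_on (l1_ball C) (\<lambda>a. \<Sum>k. a k * z ^ k)"
proof (rule uniform_limit_theorem)
  show "uniform_limit (l1_ball C) (\<lambda>N a. \<Sum>k<N. a k * z ^ k) (\<lambda>a. \<Sum>k. a k * z ^ k) sequentially"
  proof (rule Weierstrass_m_test)
    show "summable (\<lambda>k. C * norm z ^ k)"
      using assms by (intro summable_mult summable_geometric) simp
    show "norm (a k * z ^ k) \<le> C * norm z ^ k" if "a \<in> l1_ball C" for k a
      using l1_ball_norm_le[OF that] by (simp add: norm_mult norm_power mult_right_mono)
  qed
  have "continuous_on UNIV (\<lambda>a::nat \<Rightarrow> complex. \<Sum>k<N. a k * z ^ k)" for N
    by (intro continuous_intros continuous_on_product_coordinates)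
  then show "\<forall>\<^sub>F N in sequentially. continuous_on (l1_ball C) (\<lambda>a. \<Sum>k<N. a k * z ^ k)"
    by (intro always_eventually allI) (meson continuous_on_subset subset_UNIV)
qed simp

lemma wiener_algebra_sums:
  assumes "f \<in> wiener_algebra" "norm z < 1"
  shows "(\<lambda>k. taylor_coeff f k * z ^ k) sums f z"
  using holomorphic_power_series[of f 0 1 z] assms
  by (simp add: wiener_algebra_def taylor_coeff_def fps_expansion_def)

lemma power_series_in_wiener_algebra:
  fixes a :: "nat \<Rightarrow> complex"
  assumes "summable (\<lambda>k. norm (a k))"
  defines "f \<equiv> (\<lambda>z. \<Sum>k. a k * z ^ k)"
  shows "f \<in> wiener_algebra" and "wiener_norm f = (\<Sum>k. norm (a k))"
proof -
  have f: "f = eval_fps (Abs_fps a)"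
    by (simp add: f_def eval_fps_def fun_eq_iff)
  \<comment> \<open>Convergence at the point 1 forces the radius of convergence to be at least
    1.\<close>
  have "summable (\<lambda>k. a k * 1 ^ k)"
    using summable_norm_cancel[OF assms(1)] by simp
  from conv_radius_geI[OF this] have rad: "fps_conv_radius (Abs_fps a) \<ge> 1"
    by (simp add: fps_conv_radius_def one_ereal_def)
  then have "fps_conv_radius (Abs_fps a) > 0"
    by (rule less_le_trans[rotated]) simp
  then have "f has_fps_expansion Abs_fps a"
    unfolding f by (rule eval_fps_has_fps_expansion)
  then have coeff: "taylor_coeff f = a"
    by (simp add: fun_eq_iff taylor_coeff_def fps_expansion_def fps_nth_fps_expansion[symmetric])
  have "f holomorphic_on eball 0 (fps_conv_radius (Abs_fps a))"
    unfolding f by (intro holomorphic_on_eval_fps) auto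
  moreover have "ball 0 1 \<subseteq> eball (0::complex) (fps_conv_radius (Abs_fps a))"
    using rad by (intro ball_eball_mono) (simp add: one_ereal_def)
  ultimately show "f \<in> wiener_algebra"
    using assms(1) by (auto simp: wiener_algebra_def coeff intro: holomorphic_on_subset)
  show "wiener_norm f = (\<Sum>k. norm (a k))"
    by (simp add: wiener_norm_def coeff)
qed

section \<open>First-order condition at a nearest point\<close>

text \<open>The squared distance is a quadratic polynomial in \<open>t\<close> whose linear
  coefficient is \<open>-2\<close> times the real part in question; were that part positive, a small
  step would decrease the distance.\<close>

lemma first_variation_nonpos:
  fixes r d :: "'a \<Rightarrow> complex"
  assumes "\<And>t. 0 < t \<Longrightarrow> t \<le> 1 \<Longrightarrow>
    (\<Sum>i\<in>A. (norm (r i))\<^sup>2) \<le> (\<Sum>i\<in>A. (norm (r i - of_real t * d i))\<^sup>2)"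
  shows "Re (\<Sum>i\<in>A. cnj (r i) * d i) \<le> 0"
proof (rule ccontr)
  define R where "R = Re (\<Sum>i\<in>A. cnj (r i) * d i)"
  define D where "D = (\<Sum>i\<in>A. (norm (d i))\<^sup>2)"
  assume "\<not> Re (\<Sum>i\<in>A. cnj (r i) * d i) \<le> 0"
  then have "R > 0"
    by (simp add: R_def)
  have "D \<ge> 0"
    by (simp add: D_def sum_nonneg)
  \<comment> \<open>This step size lies in (0, 1] even if \<open>D = 0\<close>, and satisfies
    \<open>t * D = R - t * R < 2 * R\<close>, so the linear term beats the quadratic one.\<close>
  define t where "t = R / (R + D)"
  have t: "0 < t" "t \<le> 1" "t * (R + D) = R"
    using \<open>R > 0\<close> \<open>D \<ge> 0\<close> by (auto simp: t_def field_simps)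
  have "(norm (r i - of_real t * d i))\<^sup>2
      = (norm (r i))\<^sup>2 - 2 * t * Re (cnj (r i) * d i) + t\<^sup>2 * (norm (d i))\<^sup>2" for i
    unfolding cmod_power2 by (simp add: power2_eq_square algebra_simps)
  then have "(\<Sum>i\<in>A. (norm (r i - of_real t * d i))\<^sup>2)
      = (\<Sum>i\<in>A. (norm (r i))\<^sup>2) - 2 * t * R + t\<^sup>2 * D"
    unfolding R_def D_def Re_sum sum_distrib_left
    by (simp only: sum.distrib sum_subtractf)
  with assms[OF t(1,2)] have "t * (2 * R) \<le> t * (t * D)"
    by (simp add: power2_eq_square algebra_simps)
  then have "2 * R \<le> t * D"
    using t(1) by simp
  moreover have "0 < t * R"
    using t(1) \<open>R > 0\<close> by simp
  ultimately show False
    using t(3) \<open>R > 0\<close> unfolding distrib_left by linarith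
qed

section \<open>The two implications\<close>

text \<open>The supremum on the right bounds the exponential sum at every shifted index
  \<open>j + k\<close>, so the series over \<open>k\<close> costs only the factor
  \<open>wiener_norm f\<close>.\<close>

lemma interpolation_necessary:
  fixes l w :: "nat \<Rightarrow> complex"
  assumes f: "f \<in> wiener_algebra" "wiener_norm f \<le> C"
    and l: "\<And>i. i \<in> A \<Longrightarrow> norm (l i) < 1"
    and w: "\<And>i. i \<in> A \<Longrightarrow> f (l i) = w i"
  shows "(SUP j::nat. norm (\<Sum>i\<in>A. \<alpha> i * w i * l i ^ j))
    \<le> C * (SUP j::nat. norm (\<Sum>i\<in>A. \<alpha> i * l i ^ j))"
proof (rule cSUP_least)
  fix j :: nat
  define S where "S = (SUP j::nat. norm (\<Sum>i\<in>A. \<alpha> i * l i ^ j))"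
  let ?a = "taylor_coeff f"
  have S: "norm (\<Sum>i\<in>A. \<alpha> i * l i ^ m) \<le> S" for m
    unfolding S_def using bdd_above_exponential_sum[of A l \<alpha>] l by (intro cSUP_upper) auto
  then have "S \<ge> 0"
    using norm_ge_zero order_trans by blast
  have "(\<lambda>k. \<Sum>i\<in>A. \<alpha> i * l i ^ j * (?a k * l i ^ k)) sums (\<Sum>i\<in>A. \<alpha> i * l i ^ j * f (l i))"
    by (intro sums_sum sums_mult wiener_algebra_sums f l)
  moreover have "(\<Sum>i\<in>A. \<alpha> i * l i ^ j * (?a k * l i ^ k)) = ?a k * (\<Sum>i\<in>A. \<alpha> i * l i ^ (j + k))"
    for k
    by (simp add: sum_distrib_left power_add algebra_simps)
  moreover have "(\<Sum>i\<in>A. \<alpha> i * l i ^ j * f (l i)) = (\<Sum>i\<in>A. \<alpha> i * w i * l i ^ j)"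
    by (intro sum.cong) (simp_all add: w)
  ultimately have sums: "(\<lambda>k. ?a k * (\<Sum>i\<in>A. \<alpha> i * l i ^ (j + k))) sums
      (\<Sum>i\<in>A. \<alpha> i * w i * l i ^ j)"
    by simp
  have summ: "summable (\<lambda>k. norm (?a k) * S)"
    using f(1) by (intro summable_mult2) (simp add: wiener_algebra_def)
  have "norm (\<Sum>k. ?a k * (\<Sum>i\<in>A. \<alpha> i * l i ^ (j + k))) \<le> (\<Sum>k. norm (?a k) * S)"
    using S by (intro norm_suminf_le[OF _ summ]) (simp add: norm_mult mult_left_mono)
  also have "\<dots> = wiener_norm f * S"
    using f(1) by (simp add: wiener_norm_def wiener_algebra_def suminf_mult2)
  also have "\<dots> \<le> C * S"
    using f(2) \<open>S \<ge> 0\<close> by (rule mult_right_mono)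
  finally show "norm (\<Sum>i\<in>A. \<alpha> i * w i * l i ^ j) \<le> C * S"
    using sums_unique[OF sums] by simp
qed simp

text \<open>A separation argument: the residual at the nearest attainable tuple of values would give
  a functional separating \<open>w\<close> from all attainable tuples, which the hypothesis rules
  out.\<close>

lemma interpolation_sufficient:
  fixes l w :: "nat \<Rightarrow> complex"
  assumes "finite A" and "C \<ge> 0"
    and l: "\<And>i. i \<in> A \<Longrightarrow> norm (l i) < 1"
    and le: "\<And>\<alpha>. (SUP j::nat. norm (\<Sum>i\<in>A. \<alpha> i * w i * l i ^ j))
      \<le> C * (SUP j::nat. norm (\<Sum>i\<in>A. \<alpha> i * l i ^ j))"
  shows "\<exists>f\<in>wiener_algebra. (\<forall>i\<in>A. f (l i) = w i) \<and> wiener_norm f \<le> C"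
proof -
  define ev :: "(nat \<Rightarrow> complex) \<Rightarrow> complex \<Rightarrow> complex"
    where "ev = (\<lambda>a z. \<Sum>k. a k * z ^ k)"
  have "continuous_on (l1_ball C) (\<lambda>a. \<Sum>i\<in>A. (norm (w i - ev a (l i)))\<^sup>2)"
    unfolding ev_def by (intro continuous_intros continuous_on_power_series_eval l)
  moreover have "(\<lambda>_. 0) \<in> l1_ball C"
    using \<open>C \<ge> 0\<close> by (simp add: l1_ball_def)
  ultimately obtain a where a: "a \<in> l1_ball C"
    and min: "\<And>b. b \<in> l1_ball C \<Longrightarrow>
      (\<Sum>i\<in>A. (norm (w i - ev a (l i)))\<^sup>2) \<le> (\<Sum>i\<in>A. (norm (w i - ev b (l i)))\<^sup>2)"
    using continuous_attains_inf[OF compact_l1_ball, of C] by blast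
  define r where "r i = w i - ev a (l i)" for i
  define P where "P = (\<Sum>i\<in>A. cnj (r i) * ev a (l i))"
  \<comment> \<open>The segment from \<open>a\<close> to \<open>b\<close> stays in the ball, so the
    minimiser \<open>a\<close> also maximises the real linear functional given by
    \<open>cnj r\<close> over the attainable tuples.\<close>
  have variation: "Re (\<Sum>i\<in>A. cnj (r i) * ev b (l i)) \<le> Re P" if b: "b \<in> l1_ball C" for b
  proof -
    have "Re (\<Sum>i\<in>A. cnj (r i) * (ev b (l i) - ev a (l i))) \<le> 0"
    proof (rule first_variation_nonpos)
      fix t :: real
      assume t: "0 < t" "t \<le> 1"
      have "ev (\<lambda>k. a k + of_real t * (b k - a k)) (l i)
          = ev a (l i) + of_real t * (ev b (l i) - ev a (l i))" if "i \<in> A" for i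
      proof -
        have "summable (\<lambda>k. a k * l i ^ k)" "summable (\<lambda>k. b k * l i ^ k)"
          using l[OF that] l1_ball_summable(1)[OF a] l1_ball_summable(1)[OF b]
          by (simp_all add: summable_power_series_disk)
        then have "(\<lambda>k. a k * l i ^ k + of_real t * (b k * l i ^ k - a k * l i ^ k)) sums
            (ev a (l i) + of_real t * (ev b (l i) - ev a (l i)))"
          unfolding ev_def by (intro sums_add sums_mult sums_diff summable_sums)
        then show ?thesis
          unfolding ev_def by (simp add: sums_iff algebra_simps)
      qed
      then have "(\<Sum>i\<in>A. (norm (r i - of_real t * (ev b (l i) - ev a (l i))))\<^sup>2)
          = (\<Sum>i\<in>A. (norm (w i - ev (\<lambda>k. a k + of_real t * (b k - a k)) (l i)))\<^sup>2)"
        by (intro sum.cong) (simp_all add: r_def diff_diff_eq)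
      then show "(\<Sum>i\<in>A. (norm (r i))\<^sup>2)
          \<le> (\<Sum>i\<in>A. (norm (r i - of_real t * (ev b (l i) - ev a (l i))))\<^sup>2)"
        using min[OF convex_combination_in_l1_ball[OF a b]] t by (simp add: r_def)
    qed
    then show ?thesis
      by (simp add: P_def right_diff_distrib sum_subtractf)
  qed
  have bound: "C * norm (\<Sum>i\<in>A. cnj (r i) * l i ^ m) \<le> Re P" for m
  proof -
    define s where "s = (\<Sum>i\<in>A. cnj (r i) * l i ^ m)"
    \<comment> \<open>The phase is chosen so that \<open>c * s\<close> becomes
      \<open>C * norm s\<close>; for \<open>s = 0\<close> both vanish since
      \<open>sgn 0 = 0\<close>.\<close>
    define c where "c = of_real C * cnj (sgn s)"
    define b where "b = (\<lambda>k. if k = m then c else 0)"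
    have "norm c \<le> C"
      using \<open>C \<ge> 0\<close> by (simp add: c_def norm_mult norm_sgn)
    then have "b \<in> l1_ball C"
      unfolding b_def by (rule unit_sequence_in_l1_ball)
    moreover have "ev b z = c * z ^ m" for z
    proof -
      have "(\<lambda>k. if k = m then c * z ^ k else 0) sums (c * z ^ m)"
        by (rule sums_single)
      then show ?thesis
        by (simp add: ev_def b_def sums_iff if_distrib[of "\<lambda>x. x * _"] cong: if_cong)
    qed
    ultimately have "Re (\<Sum>i\<in>A. cnj (r i) * (c * l i ^ m)) \<le> Re P"
      using variation[of b] by simp
    also have "(\<Sum>i\<in>A. cnj (r i) * (c * l i ^ m)) = c * s"
      by (simp add: s_def sum_distrib_left algebra_simps)
    also have "cnj (sgn s) * s = of_real (norm s)"
      by (cases "s = 0")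
        (simp_all add: sgn_eq complex_norm_square[symmetric] power2_eq_square mult.commute)
    then have "c * s = of_real (C * norm s)"
      by (simp add: c_def mult.assoc)
    finally show ?thesis
      by (simp add: s_def)
  qed
  have "C * (SUP j::nat. norm (\<Sum>i\<in>A. cnj (r i) * l i ^ j)) \<le> Re P"
  \<comment> \<open>Passing to the supremum divides by \<open>C\<close>; for \<open>C = 0\<close>
    only \<open>0 \<le> Re P\<close> remains.\<close>
  proof (cases "C = 0")
    case True
    then show ?thesis
      using bound[of 0] by simp
  next
    case False
    then have "C > 0"
      using \<open>C \<ge> 0\<close> by simp
    then have "(SUP j::nat. norm (\<Sum>i\<in>A. cnj (r i) * l i ^ j)) \<le> Re P / C"
      using bound by (intro cSUP_least) (simp_all add: field_simps)
    then show ?thesis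
      using \<open>C > 0\<close> by (simp add: field_simps)
  qed
  \<comment> \<open>At \<open>j = 0\<close> the powers are 1, so the left supremum in the hypothesis
    dominates the pairing of \<open>cnj r\<close> with \<open>w\<close>.\<close>
  moreover have "norm (\<Sum>i\<in>A. cnj (r i) * w i * l i ^ 0)
      \<le> (SUP j::nat. norm (\<Sum>i\<in>A. cnj (r i) * w i * l i ^ j))"
    using bdd_above_exponential_sum[of A l "\<lambda>i. cnj (r i) * w i"] l by (intro cSUP_upper) auto
  moreover have "Re (\<Sum>i\<in>A. cnj (r i) * w i) \<le> norm (\<Sum>i\<in>A. cnj (r i) * w i * l i ^ 0)"
    unfolding power_0 mult_1_right by (rule complex_Re_le_cmod)
  ultimately have "Re (\<Sum>i\<in>A. cnj (r i) * w i) \<le> Re P"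
    using le[of "\<lambda>i. cnj (r i)"] by linarith
  \<comment> \<open>Since \<open>w i - ev a (l i) = r i\<close>, the difference of the two pairings
    is the squared distance itself.\<close>
  moreover have "(\<Sum>i\<in>A. cnj (r i) * w i) - P = of_real (\<Sum>i\<in>A. (norm (r i))\<^sup>2)"
    unfolding P_def sum_subtractf[symmetric] right_diff_distrib[symmetric] of_real_sum
    by (simp add: r_def[symmetric] complex_norm_square[symmetric] mult.commute)
  then have "Re (\<Sum>i\<in>A. cnj (r i) * w i) - Re P = (\<Sum>i\<in>A. (norm (r i))\<^sup>2)"
    by (metis Re_complex_of_real minus_complex.simps(1))
  ultimately have "(\<Sum>i\<in>A. (norm (r i))\<^sup>2) \<le> 0"
    by linarith
  then have "(\<Sum>i\<in>A. (norm (r i))\<^sup>2) = 0"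
    by (simp add: sum_nonneg order_antisym)
  then have "\<forall>i\<in>A. ev a (l i) = w i"
    using \<open>finite A\<close> by (simp add: sum_nonneg_eq_0_iff r_def)
  moreover have "ev a \<in> wiener_algebra" "wiener_norm (ev a) \<le> C"
    using power_series_in_wiener_algebra[OF l1_ball_summable(1)[OF a]] l1_ball_summable(2)[OF a]
    by (simp_all add: ev_def)
  ultimately show ?thesis
    by blast
qed

theorem corollary8:
  fixes n :: nat and l w :: "nat \<Rightarrow> complex" and C :: real
  assumes "\<And>i. i \<in> {1..n} \<Longrightarrow> l i \<in> ball 0 1"
    and "inj_on l {1..n}"
    and "C > 0"
  shows "(\<exists>f\<in>wiener_algebra. (\<forall>i\<in>{1..n}. f (l i) = w i) \<and> wiener_norm f \<le> C) \<longleftrightarrow>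
    (\<forall>\<alpha> :: nat \<Rightarrow> complex.
       (SUP j::nat. norm (\<Sum>i=1..n. \<alpha> i * w i * l i ^ j))
         \<le> C * (SUP j::nat. norm (\<Sum>i=1..n. \<alpha> i * l i ^ j)))"
proof -
  have l: "norm (l i) < 1" if "i \<in> {1..n}" for i
    using assms(1)[OF that] by simp
  show ?thesis
  proof (intro iffI allI)
    fix \<alpha> :: "nat \<Rightarrow> complex"
    assume "\<exists>f\<in>wiener_algebra. (\<forall>i\<in>{1..n}. f (l i) = w i) \<and> wiener_norm f \<le> C"
    then obtain f where "f \<in> wiener_algebra" "\<forall>i\<in>{1..n}. f (l i) = w i" "wiener_norm f \<le> C"
      by blast
    with l show "(SUP j::nat. norm (\<Sum>i=1..n. \<alpha> i * w i * l i ^ j))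
        \<le> C * (SUP j::nat. norm (\<Sum>i=1..n. \<alpha> i * l i ^ j))"
      by (intro interpolation_necessary) auto
  next
    assume "\<forall>\<alpha> :: nat \<Rightarrow> complex. (SUP j::nat. norm (\<Sum>i=1..n. \<alpha> i * w i * l i ^ j))
        \<le> C * (SUP j::nat. norm (\<Sum>i=1..n. \<alpha> i * l i ^ j))"
    then show "\<exists>f\<in>wiener_algebra. (\<forall>i\<in>{1..n}. f (l i) = w i) \<and> wiener_norm f \<le> C"
      using assms(3) l by (intro interpolation_sufficient) auto
  qed
qed

end
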